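(* Let $k$ and $h$ be positive integers with $1 \leq h \leq k$, and let $A$ be a finite set of $k$ positive integers. Then $$|h\hat{}_{\underline{+}}A| \geq 2(hk-h^2)+\binom{h+1}{2}+1.$$ Moreover, this lower bound is best possible for $h=1$, $h=2$ and $h=k$; that is, for every positive integer $k$ and every $h\in\{1,2,k\}$ with $h\leq k$, there exists a set $A$ of $k$ positive integers for which equality holds.
   Context: For a finite set $A=\{a_0,a_1,\ldots,a_{k-1}\}$ of $k$ distinct integers and an integer $1\leq h\leq k$, the $h$-fold restricted signed sumset of $A$ is $$h\hat{}_{\underline{+}}A:=\Big\{\sum_{i=0}^{k-1}\lambda_i a_i : (\lambda_0,\ldots,\lambda_{k-1})\in\{-1,0,1\}^k,\ \sum_{i=0}^{k-1}|\lambda_i|=h\Big\}.$$ $|S|$ denotes the cardinality of a finite set $S$. The binomial coefficient $\binom{a}{b}$ is $\frac{a!}{b!(a-b)!}$ if $a\geq b$ and $0$ otherwise. *)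

theory Defs
  imports Complex_Main
begin

text \<open>
  The coefficients are indexed by the elements of \<open>A\<close> themselves instead of by an enumeration
  \<open>a\<^sub>0, \<dots>, a\<^bsub>k-1\<^esub>\<close> of \<open>A\<close>; only the values of \<open>l\<close> on \<open>A\<close> matter. The notion is meant for finite \<open>A\<close>.
\<close>

definition restricted_signed_sumset :: "nat \<Rightarrow> int set \<Rightarrow> int set" where
  "restricted_signed_sumset h A =
     {(\<Sum>a\<in>A. l a * a) | l :: int \<Rightarrow> int.
        (\<forall>a\<in>A. l a \<in> {-1, 0, 1}) \<and> (\<Sum>a\<in>A. \<bar>l a\<bar>) = int h}"

end

theory Submission
  imports Defs
begin

text \<open>
  \<^bold>\<open>Lower bound.\<close> Build \<open>A\<close> up by adding its elements in increasing order, and let \<open>m\<close> be a new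
  element, larger than the \<open>k\<close> elements present so far. As long as \<open>h \<le> k\<close>, all old signed sums lie
  in \<open>[-s, s]\<close>, where \<open>s\<close> is the largest sum of an \<open>h\<close>-subset \<open>T\<close>. Exchanging one \<open>t \<in> T\<close> for \<open>m\<close>
  gives \<open>h\<close> distinct sums \<open>s - t + m\<close> above \<open>s\<close>, and their negatives lie below \<open>-s\<close>: at least \<open>2h\<close>
  sums are gained (\<open>card_rss_insert_same_fold\<close>). When \<open>h = k + 1\<close>, every element, \<open>m\<close> included,
  must be used. The sums containing \<open>-m\<close> are then a translate of the \<open>k\<close>-fold sums of the old
  elements, and beyond the largest of them lie the \<open>k + 1\<close> sums in which \<open>m\<close> has sign \<open>+\<close> and at
  most one element has sign \<open>-\<close> (\<open>card_rss_insert_full_fold\<close>). So the \<open>h\<close> smallest elements of a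
  set alone give at least \<open>1 + (1 + \<dots> + h)\<close> sums, and each larger one contributes \<open>2h\<close> more,
  which adds up to the bound.

  \<^bold>\<open>Sharpness.\<close> Given the lower bound, it suffices to confine the sums to a set of the right size.
  For \<open>{1..k}\<close> the signed sums with \<open>h = 1\<close> are nonzero and bounded by \<open>k\<close> in absolute value, and
  those with \<open>h = k\<close> lie in \<open>[-s, s]\<close> and have the parity of \<open>s = 1 + \<dots> + k\<close>. For \<open>h = 2\<close> the
  first \<open>k\<close> odd numbers work, because the sums
  \<open>\<plusminus>a \<plusminus> b\<close> are even, at most \<open>4k - 4\<close> in absolute value, and miss \<open>0\<close> as \<open>a \<noteq> b\<close>.
\<close>

section \<open>Signed sums as differences of subset sums\<close>

text \<open>
  Splitting the support of a coefficient function by sign replaces functions by pairs of disjoint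
  subsets, on which exchange arguments are easy to express.
\<close>

lemma mem_rss_iff:
  assumes "finite A"
  shows "x \<in> restricted_signed_sumset h A \<longleftrightarrow>
    (\<exists>P N. P \<subseteq> A \<and> N \<subseteq> A \<and> P \<inter> N = {} \<and> card P + card N = h \<and> x = \<Sum>P - \<Sum>N)"
proof
  assume "x \<in> restricted_signed_sumset h A"
  then obtain l :: "int \<Rightarrow> int" where l: "\<forall>a\<in>A. l a \<in> {-1, 0, 1}"
    and lh: "(\<Sum>a\<in>A. \<bar>l a\<bar>) = int h" and x: "x = (\<Sum>a\<in>A. l a * a)"
    unfolding restricted_signed_sumset_def by blast
  define P where "P = {a\<in>A. l a = 1}"
  define N where "N = {a\<in>A. l a = -1}"
  have "(\<Sum>a\<in>A. \<bar>l a\<bar>) = (\<Sum>a\<in>A. (if l a = 1 then 1 else 0) + (if l a = -1 then 1 else 0))"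
    by (rule sum.cong) (use l in auto)
  also have "\<dots> = int (card P) + int (card N)"
    using assms by (simp add: sum.distrib sum.If_cases P_def N_def Int_def)
  finally have "card P + card N = h" using lh by linarith
  moreover have "x = (\<Sum>a\<in>A. (if l a = 1 then a else 0) - (if l a = -1 then a else 0))"
    unfolding x by (rule sum.cong) (use l in auto)
  then have "x = \<Sum>P - \<Sum>N"
    using assms by (simp add: sum_subtractf sum.If_cases P_def N_def Int_def)
  ultimately show "\<exists>P N. P \<subseteq> A \<and> N \<subseteq> A \<and> P \<inter> N = {} \<and> card P + card N = h \<and> x = \<Sum>P - \<Sum>N"
    by (intro exI[of _ P] exI[of _ N]) (auto simp: P_def N_def)
next
  assume "\<exists>P N. P \<subseteq> A \<and> N \<subseteq> A \<and> P \<inter> N = {} \<and> card P + card N = h \<and> x = \<Sum>P - \<Sum>N"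
  then obtain P N where PN: "P \<subseteq> A" "N \<subseteq> A" "P \<inter> N = {}" "card P + card N = h"
    and x: "x = \<Sum>P - \<Sum>N" by blast
  define l :: "int \<Rightarrow> int" where "l a = of_bool (a \<in> P) - of_bool (a \<in> N)" for a
  have restrict: "A \<inter> P = P" "A \<inter> N = N" using PN by auto
  have "(\<Sum>a\<in>A. \<bar>l a\<bar>) = (\<Sum>a\<in>A. of_bool (a \<in> P) + of_bool (a \<in> N))"
    by (rule sum.cong) (use PN in \<open>auto simp: l_def\<close>)
  also have "\<dots> = int h"
    using assms PN restrict by (simp add: sum.distrib of_bool_def sum.If_cases)
  finally have "(\<Sum>a\<in>A. \<bar>l a\<bar>) = int h" .
  moreover have "(\<Sum>a\<in>A. l a * a) = (\<Sum>a\<in>A. (if a \<in> P then a else 0) - (if a \<in> N then a else 0))"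
    by (rule sum.cong) (auto simp: l_def)
  then have "(\<Sum>a\<in>A. l a * a) = x"
    using assms restrict by (simp add: sum_subtractf sum.If_cases x)
  moreover have "\<forall>a\<in>A. l a \<in> {-1, 0, 1}" by (auto simp: l_def)
  ultimately show "x \<in> restricted_signed_sumset h A"
    unfolding restricted_signed_sumset_def by blast
qed

lemma mem_rssI:
  assumes "finite A" "P \<subseteq> A" "N \<subseteq> A" "P \<inter> N = {}" "card P + card N = h" "x = \<Sum>P - \<Sum>N"
  shows "x \<in> restricted_signed_sumset h A"
  unfolding mem_rss_iff[OF assms(1)] using assms(2-) by (intro exI[of _ P] exI[of _ N] conjI)

lemma mem_rssE:
  assumes "finite A" "x \<in> restricted_signed_sumset h A"
  obtains P N where "P \<subseteq> A" "N \<subseteq> A" "P \<inter> N = {}" "card P + card N = h" "x = \<Sum>P - \<Sum>N"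
  using assms(2) unfolding mem_rss_iff[OF assms(1)] by (elim exE conjE) (rule that)

lemma finite_rss:
  assumes "finite A"
  shows "finite (restricted_signed_sumset h A)"
proof (rule finite_subset)
  show "restricted_signed_sumset h A \<subseteq> (\<lambda>(P, N). \<Sum>P - \<Sum>N) ` (Pow A \<times> Pow A)"
  proof
    fix x assume "x \<in> restricted_signed_sumset h A"
    with assms obtain P N where "P \<subseteq> A" "N \<subseteq> A" "x = \<Sum>P - \<Sum>N"
      by (rule mem_rssE)
    then show "x \<in> (\<lambda>(P, N). \<Sum>P - \<Sum>N) ` (Pow A \<times> Pow A)"
      by (intro image_eqI[of _ _ "(P, N)"]) auto
  qed
qed (use assms in simp)

lemma uminus_mem_rss:
  assumes "finite A" "x \<in> restricted_signed_sumset h A"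
  shows "- x \<in> restricted_signed_sumset h A"
proof -
  obtain P N where PN: "P \<subseteq> A" "N \<subseteq> A" "P \<inter> N = {}" "card P + card N = h" "x = \<Sum>P - \<Sum>N"
    using assms by (rule mem_rssE)
  show ?thesis by (rule mem_rssI[of A N P]) (use assms PN in auto)
qed

lemma rss_mono:
  assumes "A \<subseteq> B" "finite B"
  shows "restricted_signed_sumset h A \<subseteq> restricted_signed_sumset h B"
proof
  fix x assume x: "x \<in> restricted_signed_sumset h A"
  obtain P N where PN: "P \<subseteq> A" "N \<subseteq> A" "P \<inter> N = {}" "card P + card N = h" "x = \<Sum>P - \<Sum>N"
    using finite_subset[OF assms] x by (rule mem_rssE)
  show "x \<in> restricted_signed_sumset h B"
    by (rule mem_rssI[of B P N]) (use assms PN in auto)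
qed

text \<open>
  With positive elements, making all signs equal only increases the absolute value, so the extreme
  signed sums come from the \<open>h\<close>-subset with the largest sum.
\<close>

lemma ex_maximal_subset_sum:
  assumes "finite A" "\<forall>a\<in>A. 0 < a" "h \<le> card A"
  obtains T where "T \<subseteq> A" "card T = h"
    "\<forall>x\<in>restricted_signed_sumset h A. \<bar>x\<bar> \<le> \<Sum>T"
proof -
  let ?F = "{U. U \<subseteq> A \<and> card U = h}"
  have F: "finite ?F" "?F \<noteq> {}"
    using assms(1,3) obtain_subset_with_card_n by (simp, blast)
  have "Max (sum id ` ?F) \<in> sum id ` ?F"
    using F by (intro Max_in) auto
  then obtain T where T: "T \<subseteq> A" "card T = h" "Max (sum id ` ?F) = \<Sum>T"
    by (auto simp: id_def)
  have "\<bar>x\<bar> \<le> \<Sum>T" if x: "x \<in> restricted_signed_sumset h A" for x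
  proof -
    obtain P N where PN: "P \<subseteq> A" "N \<subseteq> A" "P \<inter> N = {}" "card P + card N = h" "x = \<Sum>P - \<Sum>N"
      using assms(1) x by (rule mem_rssE)
    have fin: "finite P" "finite N" using PN(1,2) assms(1) by (auto intro: finite_subset)
    have "0 \<le> \<Sum>P" "0 \<le> \<Sum>N"
      using PN(1,2) assms(2) by (auto intro!: sum_nonneg simp: subset_iff less_imp_le)
    then have "\<bar>x\<bar> \<le> \<Sum>P + \<Sum>N" using PN by simp
    also have "\<dots> = sum id (P \<union> N)" using fin PN by (simp add: sum.union_disjoint id_def)
    also have "\<dots> \<le> Max (sum id ` ?F)"
      by (rule Max_ge) (use F fin PN in \<open>auto simp: card_Un_disjoint\<close>)
    finally show ?thesis using T by simp
  qed
  then show ?thesis using T that by blast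
qed

section \<open>Gain from adding a new largest element\<close>

text \<open>
  Exchanging one element of the extremal \<open>h\<close>-subset \<open>T\<close> for the larger \<open>m\<close> yields \<open>h\<close> different
  sums above all the old ones and, by symmetry, \<open>h\<close> below them.
\<close>

lemma card_rss_insert_same_fold:
  assumes "finite A" "\<forall>a\<in>A. 0 < a" "\<forall>a\<in>A. a < m" "h \<le> card A"
  shows "card (restricted_signed_sumset h A) + 2 * h
    \<le> card (restricted_signed_sumset h (insert m A))"
proof -
  obtain T where T: "T \<subseteq> A" "card T = h"
    and bound: "\<forall>x\<in>restricted_signed_sumset h A. \<bar>x\<bar> \<le> \<Sum>T"
    using assms(1,2,4) by (rule ex_maximal_subset_sum)
  have finT: "finite T" using T assms(1) finite_subset by auto
  have T_nonneg: "0 \<le> \<Sum>T"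
    using T(1) assms(2) by (auto intro!: sum_nonneg simp: subset_iff less_imp_le)
  define U where "U = (\<lambda>t. \<Sum>T - t + m) ` T"
  define R where "R = restricted_signed_sumset h A"
  have card_U: "card U = h" "card (uminus ` U) = h"
    using T(2) by (auto simp: U_def card_image inj_on_def)
  have finU: "finite U" using finT by (simp add: U_def)
  have finR: "finite R" using assms(1) by (simp add: R_def finite_rss)
  have U_large: "\<forall>u\<in>U. \<Sum>T < u"
    using T(1) assms(3) by (auto simp: U_def)
  then have U_small: "\<forall>u\<in>uminus ` U. u < - \<Sum>T" by auto
  have U_sub: "U \<subseteq> restricted_signed_sumset h (insert m A)"
  proof
    fix u assume "u \<in> U"
    then obtain t where t: "t \<in> T" "u = \<Sum>T - t + m" by (auto simp: U_def)
    have m: "m \<notin> T" using T(1) assms(3) by auto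
    show "u \<in> restricted_signed_sumset h (insert m A)"
    proof (rule mem_rssI[of _ "insert m (T - {t})" "{}"])
      show "card (insert m (T - {t})) + card {} = h"
        using finT t m T(2) card_gt_0_iff[of T] by auto
      show "u = \<Sum>(insert m (T - {t})) - \<Sum>{}"
        using finT t m by (simp add: sum_diff1)
    qed (use assms(1) T in auto)
  qed
  then have "uminus ` U \<subseteq> restricted_signed_sumset h (insert m A)"
    using assms(1) uminus_mem_rss[of "insert m A"] by auto
  with U_sub have "R \<union> (U \<union> uminus ` U) \<subseteq> restricted_signed_sumset h (insert m A)"
    using rss_mono[of A "insert m A" h] assms(1) by (auto simp: R_def)
  then have "card (R \<union> (U \<union> uminus ` U)) \<le> card (restricted_signed_sumset h (insert m A))"
    using assms(1) by (intro card_mono finite_rss) auto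
  moreover have "U \<inter> uminus ` U = {}"
  proof -
    have "u \<notin> uminus ` U" if "u \<in> U" for u
    proof
      assume "u \<in> uminus ` U"
      with U_small have "u < - \<Sum>T" by blast
      moreover have "\<Sum>T < u" using U_large that by blast
      ultimately show False using T_nonneg by linarith
    qed
    then show ?thesis by blast
  qed
  moreover have "R \<inter> (U \<union> uminus ` U) = {}"
    using U_large U_small bound by (fastforce simp: R_def)
  ultimately show ?thesis
    using finU finR card_U by (simp add: card_Un_disjoint R_def)
qed

text \<open>
  In the full fold, giving \<open>m\<close> the sign \<open>-\<close> reproduces the old sums, shifted by \<open>-m\<close>, so none of
  these exceeds \<open>\<Sum>A - m\<close>. Flipping the sign of at most one \<open>b\<close> in the all-positive sum gives the
  \<open>card A + 1\<close> sums \<open>\<Sum>A + m - 2b\<close> with \<open>b \<in> A \<union> {0}\<close>, all above \<open>\<Sum>A - m\<close> since \<open>b < m\<close>.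
\<close>

lemma card_rss_insert_full_fold:
  assumes "finite A" "\<forall>a\<in>A. 0 < a" "\<forall>a\<in>A. a < m" "0 < m"
  shows "card (restricted_signed_sumset (card A) A) + (card A + 1)
    \<le> card (restricted_signed_sumset (card A + 1) (insert m A))"
proof -
  define L where "L = (\<lambda>x. x - m) ` restricted_signed_sumset (card A) A"
  define U where "U = (\<lambda>b. \<Sum>A + m - 2 * b) ` insert 0 A"
  have m: "m \<notin> A" using assms(3) by auto
  have finL: "finite L" and finU: "finite U"
    using assms(1) by (auto simp: L_def U_def finite_rss)
  have card_L: "card L = card (restricted_signed_sumset (card A) A)"
    unfolding L_def by (rule card_image) simp
  have "card U = card (insert 0 A)"
    unfolding U_def by (rule card_image) (auto simp: inj_on_def)
  also have "\<dots> = card A + 1" using assms(1,2) by (subst card_insert_disjoint) auto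
  finally have card_U: "card U = card A + 1" .
  obtain T where T: "T \<subseteq> A" "card T = card A"
    and bound: "\<forall>x\<in>restricted_signed_sumset (card A) A. \<bar>x\<bar> \<le> \<Sum>T"
    using assms(1,2) order_refl by (rule ex_maximal_subset_sum)
  have "T = A" using T assms(1) card_subset_eq by blast
  then have "\<forall>x\<in>L. x \<le> \<Sum>A - m"
    using bound by (fastforce simp: L_def)
  moreover have "\<forall>x\<in>U. \<Sum>A - m < x"
    using assms(3,4) by (auto simp: U_def)
  ultimately have disj: "L \<inter> U = {}" by fastforce
  have "L \<subseteq> restricted_signed_sumset (card A + 1) (insert m A)"
  proof
    fix y assume "y \<in> L"
    then obtain x where x: "x \<in> restricted_signed_sumset (card A) A" "y = x - m"
      by (auto simp: L_def)
    obtain P N where PN: "P \<subseteq> A" "N \<subseteq> A" "P \<inter> N = {}" "card P + card N = card A" "x = \<Sum>P - \<Sum>N"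
      using assms(1) x(1) by (rule mem_rssE)
    have "finite N" "m \<notin> N" "m \<notin> P" using PN assms(1) m finite_subset by auto
    then show "y \<in> restricted_signed_sumset (card A + 1) (insert m A)"
      by (intro mem_rssI[of _ P "insert m N"]) (use assms(1) PN x in auto)
  qed
  moreover have "U \<subseteq> restricted_signed_sumset (card A + 1) (insert m A)"
  proof
    fix y assume "y \<in> U"
    then obtain b where b: "b = 0 \<or> b \<in> A" "y = \<Sum>A + m - 2 * b" by (auto simp: U_def)
    \<comment> \<open>For \<open>b = 0 \<notin> A\<close> this makes no element negative.\<close>
    define N where "N = A \<inter> {b}"
    have "finite N" "\<Sum>N = b" and N: "N \<subseteq> A"
      using b(1) assms(2) by (auto simp: N_def)
    moreover have "card (insert m A - N) = card (insert m A) - card N"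
      using \<open>finite N\<close> N by (intro card_Diff_subset) auto
    moreover have "card N \<le> card A" using assms(1) N by (rule card_mono)
    moreover have "\<Sum>(insert m A - N) = \<Sum>(insert m A) - \<Sum>N"
      using assms(1) N by (intro sum_diff) auto
    ultimately show "y \<in> restricted_signed_sumset (card A + 1) (insert m A)"
      by (intro mem_rssI[of _ "insert m A - N" N]) (use assms(1) m b(2) in auto)
  qed
  ultimately have "card (L \<union> U) \<le> card (restricted_signed_sumset (card A + 1) (insert m A))"
    using assms(1) by (intro card_mono finite_rss) auto
  then show ?thesis
    using finL finU disj card_L card_U by (simp add: card_Un_disjoint)
qed

section \<open>The lower bound\<close>

lemma card_rss_ge:
  assumes "finite A" "\<forall>a\<in>A. 0 < a" "h \<le> card A"
  shows "2 * (int h * int (card A) - (int h)\<^sup>2) + int ((h + 1) choose 2) + 1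
    \<le> int (card (restricted_signed_sumset h A))"
  using assms
proof (induction A arbitrary: h rule: finite_linorder_max_induct)
  case empty
  have "0 \<in> restricted_signed_sumset 0 {}"
    by (rule mem_rssI[of _ "{}" "{}"]) auto
  then have "card (restricted_signed_sumset 0 {}) > 0"
    by (auto simp: card_gt_0_iff finite_rss)
  then show ?case using empty by (simp add: numeral_2_eq_2)
next
  case (insert m A)
  have m: "m \<notin> A" using insert.hyps by auto
  then have card: "card (insert m A) = card A + 1" using insert.hyps by simp
  have pos: "\<forall>a\<in>A. 0 < a" "0 < m" using insert.prems by auto
  show ?case
  proof (cases "h \<le> card A")
    case True
    have "card (restricted_signed_sumset h A) + 2 * h
        \<le> card (restricted_signed_sumset h (insert m A))"
      using insert.hyps pos True by (intro card_rss_insert_same_fold) auto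
    with insert.IH[OF pos(1) True] show ?thesis
      unfolding card by (simp add: algebra_simps)
  next
    case False
    then have h: "h = card A + 1" using insert.prems card by simp
    have "card (restricted_signed_sumset (card A) A) + (card A + 1)
        \<le> card (restricted_signed_sumset h (insert m A))"
      unfolding h using insert.hyps pos by (intro card_rss_insert_full_fold) auto
    moreover have "(h + 1) choose 2 = ((card A + 1) choose 2) + (card A + 1)"
      by (simp add: h numeral_2_eq_2)
    ultimately show ?thesis
      using insert.IH[OF pos(1) order_refl]
      unfolding card h by (simp add: power2_eq_square)
  qed
qed

section \<open>Sets attaining the bound\<close>

lemma card_rss_one_interval_le:
  "card (restricted_signed_sumset 1 {1..int k}) \<le> 2 * k"
proof -
  have "restricted_signed_sumset 1 {1..int k} \<subseteq> {- int k..int k} - {0}"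
  proof
    fix x assume "x \<in> restricted_signed_sumset 1 {1..int k}"
    then obtain P N where PN: "P \<subseteq> {1..int k}" "N \<subseteq> {1..int k}" "card P + card N = 1"
      "x = \<Sum>P - \<Sum>N"
      by (rule mem_rssE[rotated]) auto
    have "finite P" "finite N" using PN finite_subset by blast+
    with PN(3) have "(\<exists>a. P = {a} \<and> N = {}) \<or> (\<exists>a. P = {} \<and> N = {a})"
      by (auto simp: add_is_1 card_1_singleton_iff)
    with PN show "x \<in> {- int k..int k} - {0}" by auto
  qed
  then have "card (restricted_signed_sumset 1 {1..int k}) \<le> card ({- int k..int k} - {0})"
    by (intro card_mono) auto
  then show ?thesis by simp
qed

text \<open>
  When all elements are used, a signed sum differs from \<open>\<Sum>A\<close> by twice the sum of the elements with
  sign \<open>-\<close>, which lies between \<open>0\<close> and \<open>\<Sum>A\<close>.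
\<close>

lemma card_rss_full_fold_le:
  assumes "finite A" "\<forall>a\<in>A. 0 < a"
  shows "int (card (restricted_signed_sumset (card A) A)) \<le> \<Sum>A + 1"
proof -
  have "restricted_signed_sumset (card A) A \<subseteq> (\<lambda>j. \<Sum>A - 2 * j) ` {0..\<Sum>A}"
  proof
    fix x assume "x \<in> restricted_signed_sumset (card A) A"
    with assms(1) obtain P N where PN: "P \<subseteq> A" "N \<subseteq> A" "P \<inter> N = {}" "card P + card N = card A"
      "x = \<Sum>P - \<Sum>N"
      by (rule mem_rssE)
    have fin: "finite P" "finite N" using PN(1,2) assms(1) by (auto intro: finite_subset)
    have "P \<union> N = A"
      using PN fin assms(1) by (intro card_subset_eq) (auto simp: card_Un_disjoint)
    then have sum_A: "\<Sum>A = \<Sum>P + \<Sum>N" using PN fin sum.union_disjoint by blast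
    have "0 \<le> \<Sum>P" "0 \<le> \<Sum>N"
      using PN(1,2) assms(2) by (auto intro!: sum_nonneg simp: subset_iff less_imp_le)
    with PN(5) sum_A show "x \<in> (\<lambda>j. \<Sum>A - 2 * j) ` {0..\<Sum>A}"
      by (intro image_eqI[of _ _ "\<Sum>N"]) auto
  qed
  then have "card (restricted_signed_sumset (card A) A) \<le> card {0..\<Sum>A}"
    by (meson finite_atLeastAtMost_int surj_card_le)
  moreover have "0 \<le> \<Sum>A" using assms(2) by (auto intro!: sum_nonneg simp: less_imp_le)
  ultimately show ?thesis by simp
qed

lemma card_rss_two_odds_le:
  assumes "2 \<le> k"
  shows "card (restricted_signed_sumset 2 ((\<lambda>i. 2 * i + 1) ` {0..<int k})) \<le> 4 * k - 4"
proof -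
  let ?A = "(\<lambda>i. 2 * i + 1) ` {0..<int k}"
  let ?J = "{- (2 * int k - 2)..2 * int k - 2} - {0}"
  have "restricted_signed_sumset 2 ?A \<subseteq> (\<lambda>j. 2 * j) ` ?J"
  proof
    fix x assume "x \<in> restricted_signed_sumset 2 ?A"
    then obtain P N where PN: "P \<subseteq> ?A" "N \<subseteq> ?A" "P \<inter> N = {}" "card P + card N = 2"
      "x = \<Sum>P - \<Sum>N"
      by (rule mem_rssE[rotated]) auto
    have fin: "finite P" "finite N"
      using PN(1,2) by (auto intro: finite_subset[OF _ finite_imageI])
    have "card P = 2 \<and> card N = 0 \<or> card P = 1 \<and> card N = 1 \<or> card P = 0 \<and> card N = 2"
      using PN(4) by linarith
    then have "\<exists>a b. a \<noteq> b \<and> a \<in> ?A \<and> b \<in> ?A \<and> x \<in> {a + b, a - b, - (a + b)}"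
    proof (elim disjE conjE)
      assume "card P = 2" "card N = 0"
      then obtain a b where "P = {a, b}" "a \<noteq> b" "N = {}" using fin by (auto simp: card_2_iff)
      then show ?thesis using PN by (intro exI[of _ a] exI[of _ b]) simp
    next
      assume "card P = 1" "card N = 1"
      then obtain a b where "P = {a}" "N = {b}" by (auto simp: card_1_singleton_iff)
      then show ?thesis using PN by (intro exI[of _ a] exI[of _ b]) auto
    next
      assume "card P = 0" "card N = 2"
      then obtain a b where "N = {a, b}" "a \<noteq> b" "P = {}" using fin by (auto simp: card_2_iff)
      then show ?thesis using PN by (intro exI[of _ a] exI[of _ b]) simp
    qed
    then obtain i j where ij: "i \<noteq> j" "0 \<le> i" "i < int k" "0 \<le> j" "j < int k"
      and x: "x = 2 * (i + j + 1) \<or> x = 2 * (i - j) \<or> x = 2 * (- (i + j + 1))"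
      by fastforce
    from ij have "i + j + 1 \<in> ?J" "i - j \<in> ?J" "- (i + j + 1) \<in> ?J" by auto
    with x show "x \<in> (\<lambda>j. 2 * j) ` ?J" by blast
  qed
  then have "card (restricted_signed_sumset 2 ?A) \<le> card ?J"
    by (rule surj_card_le[rotated]) simp
  also have "\<dots> = 4 * k - 4" using assms by (simp add: nat_diff_distrib)
  finally show ?thesis .
qed

section \<open>The bound and its sharpness\<close>

theorem theorem2p1:
  shows "(\<forall>(k::nat) (h::nat) (A::int set).
            1 \<le> h \<and> h \<le> k \<and> finite A \<and> card A = k \<and> (\<forall>a\<in>A. 0 < a) \<longrightarrow>
            int (card (restricted_signed_sumset h A))
              \<ge> 2 * (int h * int k - (int h)\<^sup>2) + int ((h + 1) choose 2) + 1)
       \<and> (\<forall>(k::nat) (h::nat).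
            1 \<le> k \<and> h \<in> {1, 2, k} \<and> h \<le> k \<longrightarrow>
            (\<exists>A::int set. finite A \<and> card A = k \<and> (\<forall>a\<in>A. 0 < a) \<and>
               int (card (restricted_signed_sumset h A))
                 = 2 * (int h * int k - (int h)\<^sup>2) + int ((h + 1) choose 2) + 1))"
proof (intro conjI allI impI)
  fix k h :: nat and A :: "int set"
  assume "1 \<le> h \<and> h \<le> k \<and> finite A \<and> card A = k \<and> (\<forall>a\<in>A. 0 < a)"
  then show "int (card (restricted_signed_sumset h A))
      \<ge> 2 * (int h * int k - (int h)\<^sup>2) + int ((h + 1) choose 2) + 1"
    using card_rss_ge by blast
next
  fix k h :: nat
  assume kh: "1 \<le> k \<and> h \<in> {1, 2, k} \<and> h \<le> k"
  let ?b = "2 * (int h * int k - (int h)\<^sup>2) + int ((h + 1) choose 2) + 1"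
  have "\<exists>A::int set. finite A \<and> card A = k \<and> (\<forall>a\<in>A. 0 < a) \<and>
      int (card (restricted_signed_sumset h A)) \<le> ?b"
  proof -
    consider "h = 1" | "h = 2" | "h = k" using kh by auto
    then show ?thesis
    proof cases
      case 1
      have "int (card (restricted_signed_sumset h {1..int k})) \<le> ?b"
        using card_rss_one_interval_le[of k] by (simp add: 1 choose_two)
      then show ?thesis by (intro exI[of _ "{1..int k}"]) auto
    next
      case 2
      let ?A = "(\<lambda>i. 2 * i + 1) ` {0..<int k}"
      have "int (card (restricted_signed_sumset h ?A)) \<le> ?b"
        using zle_int[THEN iffD2, OF card_rss_two_odds_le[of k]] kh
        by (simp add: 2 choose_two of_nat_diff)
      moreover have "card ?A = k" by (simp add: card_image inj_on_def)
      ultimately show ?thesis by (intro exI[of _ ?A]) auto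
    next
      case 3
      have "\<Sum>{1..int n} = int ((n + 1) choose 2)" for n
      proof (induction n)
        case (Suc n)
        have "{1..int (Suc n)} = insert (int (Suc n)) {1..int n}" by auto
        with Suc show ?case by (simp add: numeral_2_eq_2)
      qed simp
      then have "int (card (restricted_signed_sumset h {1..int k})) \<le> ?b"
        using card_rss_full_fold_le[of "{1..int k}"] by (simp add: 3 power2_eq_square)
      then show ?thesis by (intro exI[of _ "{1..int k}"]) auto
    qed
  qed
  then obtain A :: "int set" where A: "finite A" "card A = k" "\<forall>a\<in>A. 0 < a"
    "int (card (restricted_signed_sumset h A)) \<le> ?b" by blast
  moreover have "?b \<le> int (card (restricted_signed_sumset h A))"
    using card_rss_ge[of A h] A kh by simp
  ultimately show "\<exists>A::int set. finite A \<and> card A = k \<and> (\<forall>a\<in>A. 0 < a) \<and>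
      int (card (restricted_signed_sumset h A)) = ?b"
    by (intro exI[of _ A]) simp
qed

end
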